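(* Let $\omega=(-1+\sqrt{-3})/2$. For every positive integer $m$ and every odd integer $n\ge 3$, $$\sum_{\substack{0\le k\le n\\ 6\mid k-3}}\binom nkm^kB_{n-k}=\frac n3\Big\{\sum_{r=1}^{m-1}r^{n-1}-\sum_{r=1}^{\lfloor (m-1)/2\rfloor}\big((r+m\omega)^{n-1}+(r+m\omega^2)^{n-1}\big)+\delta(m,n)\Big\},$$ where $$\delta(m,n)=\begin{cases} -\frac 12m^{n-1}&\text{if $m$ is odd and $3\mid n-1$,}\\ m^{n-1}&\text{if $m$ is odd and $3\nmid n-1$,}\\ -\frac 12m^{n-1}-(-3)^{\frac{n-1}2}(m/2)^{n-1}&\text{if $m$ is even and $3\mid n-1$,}\\ m^{n-1}-(-3)^{\frac{n-1}2}(m/2)^{n-1}&\text{if $m$ is even and $3\nmid n-1$.}\end{cases}$$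
   Context: The Bernoulli numbers $B_n$ are defined by $B_0=1$ and $\sum_{k=0}^{n-1}\binom nkB_k=0$ for $n\ge 2$. $\lfloor y\rfloor$ denotes the greatest integer not exceeding $y$. *)

theory Defs
  imports Complex_Main
begin

text \<open>The recurrence \<open>(\<Sum>k<n. (n choose k) * B\<^sub>k) = 0\<close> for \<open>n \<ge> 2\<close>, solved for its last
  term \<open>B\<^sub>n\<^sub>-\<^sub>1\<close>. The two lemmas below confirm that this is the sequence it determines.\<close>

fun bernoulli :: "nat \<Rightarrow> real" where
  "bernoulli 0 = 1"
| "bernoulli (Suc n) =
     - (\<Sum>k\<le>n. real ((n + 2) choose k) * bernoulli k) / real (n + 2)"

lemma bernoulli_recurrence:
  assumes "n \<ge> 2"
  shows "(\<Sum>k<n. real (n choose k) * bernoulli k) = 0"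
proof -
  obtain j where n: "n = Suc (Suc j)"
    using assms by (metis One_nat_def Suc_1 Suc_le_D Suc_le_mono)
  have c: "Suc (Suc j) choose Suc j = Suc (Suc j)"
    by (metis binomial_Suc_n)
  show ?thesis
    unfolding n sum.lessThan_Suc[of _ "Suc j"] c lessThan_Suc_atMost
    by (simp del: binomial_Suc_Suc of_nat_Suc)
qed

lemma bernoulli_unique:
  fixes B :: "nat \<Rightarrow> real"
  assumes "B 0 = 1" "\<And>n. n \<ge> 2 \<Longrightarrow> (\<Sum>k<n. real (n choose k) * B k) = 0"
  shows "B n = bernoulli n"
proof (induction n rule: less_induct)
  case (less n)
  show ?case
  proof (cases n)
    case 0
    then show ?thesis using assms(1) by simp
  next
    case (Suc j)
    have eq: "(\<Sum>k<Suc j. real (Suc (Suc j) choose k) * B k) =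
              (\<Sum>k<Suc j. real (Suc (Suc j) choose k) * bernoulli k)"
      using less.IH Suc by (intro sum.cong) auto
    have "(\<Sum>k<Suc (Suc j). real (Suc (Suc j) choose k) * B k) =
          (\<Sum>k<Suc (Suc j). real (Suc (Suc j) choose k) * bernoulli k)"
      using assms(2)[of "Suc (Suc j)"] bernoulli_recurrence[of "Suc (Suc j)"] by simp
    then have "real (Suc (Suc j) choose Suc j) * B (Suc j) =
               real (Suc (Suc j) choose Suc j) * bernoulli (Suc j)"
      unfolding sum.lessThan_Suc[of _ "Suc j"] eq by linarith
    moreover have "real (Suc (Suc j) choose Suc j) \<noteq> 0"
      by (metis binomial_Suc_n of_nat_eq_0_iff nat.distinct(1))
    ultimately show ?thesis using Suc mult_left_cancel by blast
  qed
qed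

definition omega :: complex where
  "omega = (- 1 + csqrt (- 3)) / 2"

text \<open>Only meant for odd \<open>n\<close>, where \<open>(n - 1) div 2\<close> is exact.\<close>

definition delta :: "nat \<Rightarrow> nat \<Rightarrow> real" where
  "delta m n =
     (if odd m then
        (if 3 dvd n - 1 then - (1 / 2) * real m ^ (n - 1)
         else real m ^ (n - 1))
      else
        (if 3 dvd n - 1 then
           - (1 / 2) * real m ^ (n - 1) - (- 3) ^ ((n - 1) div 2) * (real m / 2) ^ (n - 1)
         else real m ^ (n - 1) - (- 3) ^ ((n - 1) div 2) * (real m / 2) ^ (n - 1)))"

end

theory Submission
  imports Defs "HOL-Computational_Algebra.Formal_Power_Series"
begin

text \<open>
  A sixth-roots-of-unity filter turns the left-hand side into values of the Bernoulli polynomial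
  \<open>B\<^sub>n\<close> at \<open>\<plusminus>m\<close>, \<open>\<plusminus>m\<omega>\<close>, \<open>\<plusminus>m\<omega>\<^sup>2\<close>. For odd \<open>n\<close> the reflection \<open>B\<^sub>n(1 - x) = -B\<^sub>n(x)\<close> and the
  difference equation \<open>B\<^sub>n(x + 1) - B\<^sub>n(x) = n x\<^bsup>n-1\<^esup>\<close> remove the signs. Since
  \<open>m\<omega>\<^sup>2 = -m - m\<omega>\<close>, reflection also gives \<open>B\<^sub>n(m\<omega>\<^sup>2) = -B\<^sub>n(m\<omega> + m + 1)\<close>, so
  \<open>B\<^sub>n(m\<omega>) + B\<^sub>n(m\<omega>\<^sup>2)\<close> telescopes to a power sum over \<open>r + m\<omega>\<close> with \<open>0 \<le> r \<le> m\<close>, in which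
  \<open>r\<close> is paired with \<open>m - r\<close>.
\<close>

section \<open>Bernoulli polynomials through their generating function\<close>

definition bernoulli_fps :: "complex fps" where
  "bernoulli_fps = Abs_fps (\<lambda>n. of_real (bernoulli n) / fact n)"

definition bernoulli_poly :: "nat \<Rightarrow> complex \<Rightarrow> complex" where
  "bernoulli_poly n x = (\<Sum>k\<le>n. of_nat (n choose k) * x ^ k * of_real (bernoulli (n - k)))"

lemma bernoulli_poly_fps_nth:
  "bernoulli_poly n x = fact n * fps_nth (fps_exp x * bernoulli_fps) n"
  unfolding bernoulli_poly_def fps_mult_nth sum_distrib_left
  by (intro sum.cong) (auto simp: bernoulli_fps_def binomial_fact atLeast0AtMost)

text \<open>The defining recurrence in generating-function form: \<open>fps_exp 1 - 1\<close> has no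
  constant term, so the n-th coefficient is the recurrence sum over i < n, divided by n!.\<close>

lemma bernoulli_fps_mult_exp: "bernoulli_fps * (fps_exp 1 - 1) = fps_X"
proof (rule fps_ext)
  fix n
  have "fps_nth (bernoulli_fps * (fps_exp 1 - 1)) n =
      (\<Sum>i\<le>n. if i < n then of_nat (n choose i) * of_real (bernoulli i) / fact n else 0)"
    unfolding fps_mult_nth atLeast0AtMost
    by (intro sum.cong) (auto simp: bernoulli_fps_def binomial_fact)
  also have "\<dots> = (\<Sum>i<n. of_nat (n choose i) * of_real (bernoulli i) / fact n)"
    by (intro sum.mono_neutral_cong_right) auto
  also have "\<dots> = of_real (\<Sum>i<n. real (n choose i) * bernoulli i) / fact n"
    by (simp add: sum_divide_distrib)
  also have "\<dots> = fps_nth fps_X n"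
  proof (cases "n \<ge> 2")
    case True
    then show ?thesis by (simp add: bernoulli_recurrence)
  next
    case False
    then have "n = 0 \<or> n = 1" by auto
    then show ?thesis by auto
  qed
  finally show "fps_nth (bernoulli_fps * (fps_exp 1 - 1)) n = fps_nth fps_X n" .
qed

text \<open>Raising x by 1 multiplies the generating function by e^t, and the factor e^t - 1 in the
  difference cancels the denominator of t / (e^t - 1).\<close>

lemma bernoulli_poly_add_1:
  "bernoulli_poly n (x + 1) = bernoulli_poly n x + of_nat n * x ^ (n - 1)"
proof -
  have "fps_exp (x + 1) * bernoulli_fps - fps_exp x * bernoulli_fps =
      fps_exp x * (bernoulli_fps * (fps_exp 1 - 1))"
    unfolding fps_exp_add_mult by (simp add: algebra_simps)
  then have "fps_exp (x + 1) * bernoulli_fps = fps_exp x * bernoulli_fps + fps_exp x * fps_X"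
    unfolding bernoulli_fps_mult_exp by (metis add.commute diff_eq_eq)
  moreover have "fact n * fps_nth (fps_exp x * fps_X) n = of_nat n * x ^ (n - 1)"
    by (cases n) (auto simp: field_simps simp del: of_nat_Suc)
  ultimately show ?thesis
    by (simp add: bernoulli_poly_fps_nth distrib_left)
qed

lemma bernoulli_poly_add_of_nat:
  "bernoulli_poly n (x + of_nat N) =
     bernoulli_poly n x + of_nat n * (\<Sum>r<N. (of_nat r + x) ^ (n - 1))"
proof (induction N)
  case (Suc N)
  show ?case
    using bernoulli_poly_add_1[of n "x + of_nat N"] Suc
    by (simp add: algebra_simps)
qed simp

text \<open>Replacing t by -t turns t / (e^t - 1) into e^t * t / (e^t - 1); on coefficients this
  substitution is the factor (-1)^n.\<close>

lemma bernoulli_poly_reflect: "bernoulli_poly n (1 - x) = (- 1) ^ n * bernoulli_poly n x"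
proof -
  let ?N = "fps_const (-1) * fps_X :: complex fps"
  let ?G = "bernoulli_fps oo ?N"
  have e: "fps_exp c oo ?N = fps_exp (- c)" for c :: complex
    by (simp add: fps_compose_linear fps_eq_iff power_mult_distrib[symmetric])
  have "(bernoulli_fps * (fps_exp 1 - 1)) oo ?N = ?G * (fps_exp (- 1) - 1)"
    by (simp add: fps_compose_mult_distrib fps_compose_sub_distrib e del: fps_const_neg)
  moreover have "?N = - fps_X"
    by (simp add: fps_eq_iff)
  ultimately have "?G * (fps_exp (- 1) - 1) = - fps_X"
    by (simp add: bernoulli_fps_mult_exp)
  moreover have "fps_exp (- 1) * fps_exp 1 = (1 :: complex fps)"
    by (simp flip: fps_exp_add_mult)
  then have "?G * (fps_exp 1 - 1) = - (?G * (fps_exp (- 1) - 1)) * fps_exp 1"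
    by (simp add: left_diff_distrib right_diff_distrib mult.assoc)
  ultimately have "?G * (fps_exp 1 - 1) = fps_X * fps_exp 1"
    by simp
  also have "\<dots> = fps_exp 1 * bernoulli_fps * (fps_exp 1 - 1)"
    by (simp add: bernoulli_fps_mult_exp mult.assoc mult.commute)
  finally have "?G * (fps_exp 1 - 1) = fps_exp 1 * bernoulli_fps * (fps_exp 1 - 1)" .
  \<comment> \<open>Permits cancellation: if the factor were 0,
    \<open>bernoulli_fps_mult_exp\<close> would force \<open>fps_X\<close> to be 0.\<close>
  moreover have "fps_exp 1 - 1 \<noteq> (0 :: complex fps)"
    using bernoulli_fps_mult_exp by auto
  ultimately have "?G = fps_exp 1 * bernoulli_fps"
    by (rule mult_right_cancel[THEN iffD1, rotated])
  moreover have "(fps_exp x * bernoulli_fps) oo ?N = fps_exp (- x) * ?G"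
    by (simp add: fps_compose_mult_distrib e del: fps_const_neg)
  moreover have "fps_exp (1 - x) = fps_exp (- x) * fps_exp 1"
    by (simp flip: fps_exp_add_mult)
  ultimately have "fps_exp (1 - x) * bernoulli_fps = (fps_exp x * bernoulli_fps) oo ?N"
    by (simp only: mult.assoc)
  then show ?thesis
    by (simp add: bernoulli_poly_fps_nth fps_compose_linear del: fps_const_neg)
qed

section \<open>Powers of \<open>omega\<close> and the sixth-roots-of-unity filter\<close>

lemma omega_squared: "omega\<^sup>2 = - 1 - omega"
proof -
  have "csqrt (- 3) ^ 2 = - 3" by (rule power2_csqrt)
  then show ?thesis unfolding omega_def by (simp add: power2_eq_square field_simps)
qed

lemma omega_cubed: "omega ^ 3 = 1"
proof -
  have "omega ^ 3 - 1 = (omega - 1) * (omega\<^sup>2 + omega + 1)"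
    by (simp add: power3_eq_cube power2_eq_square algebra_simps)
  then show ?thesis by (simp add: omega_squared)
qed

lemma omega_power_sum:
  "1 + omega ^ k + (omega\<^sup>2) ^ k = (if 3 dvd k then 3 else 0)"
proof -
  have "omega ^ k = omega ^ (k mod 3)"
    by (metis mult_div_mod_eq omega_cubed power_add power_mult power_one mult_1)
  moreover have "(omega\<^sup>2) ^ k = (omega ^ k)\<^sup>2"
    by (simp add: power_mult[symmetric] mult.commute)
  moreover have "(omega\<^sup>2)\<^sup>2 = omega"
    using arg_cong[OF omega_cubed, of "(*) omega"]
    by (simp add: power2_eq_square power3_eq_cube mult.assoc)
  moreover have "k mod 3 = 0 \<or> k mod 3 = 1 \<or> k mod 3 = 2" by auto
  ultimately show ?thesis
    by (auto simp: omega_squared dvd_eq_mod_eq_0)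
qed

lemma bernoulli_poly_filter:
  "(\<Sum>k | k \<le> n \<and> (6::int) dvd int k - 3.
      of_nat (n choose k) * x ^ k * complex_of_real (bernoulli (n - k))) =
   (bernoulli_poly n x + bernoulli_poly n (x * omega) + bernoulli_poly n (x * omega\<^sup>2)
    - bernoulli_poly n (- x) - bernoulli_poly n (- (x * omega))
    - bernoulli_poly n (- (x * omega\<^sup>2))) / 6"
proof -
  define c where "c k = of_nat (n choose k) * complex_of_real (bernoulli (n - k))" for k
  have P: "bernoulli_poly n y = (\<Sum>k\<le>n. c k * y ^ k)" for y
    by (simp add: bernoulli_poly_def c_def mult_ac)
  \<comment> \<open>Parity is detected by 1 - (-1)^k, divisibility by 3 by
    \<open>omega_power_sum\<close>. Over the integers k = 0 is excluded; truncated subtraction would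
    admit it.\<close>
  have six: "(6::int) dvd int k - 3 \<longleftrightarrow> odd k \<and> 3 dvd k" for k
    by presburger
  have "c k * x ^ k + c k * (x * omega) ^ k + c k * (x * omega\<^sup>2) ^ k
      - c k * (- x) ^ k - c k * (- (x * omega)) ^ k - c k * (- (x * omega\<^sup>2)) ^ k =
      (if (6::int) dvd int k - 3 then 6 * (c k * x ^ k) else 0)" for k
  proof -
    have "c k * x ^ k + c k * (x * omega) ^ k + c k * (x * omega\<^sup>2) ^ k
      - c k * (- x) ^ k - c k * (- (x * omega)) ^ k - c k * (- (x * omega\<^sup>2)) ^ k =
      (1 - (- 1) ^ k) * (c k * x ^ k) * (1 + omega ^ k + (omega\<^sup>2) ^ k)"
      by (simp add: power_mult_distrib power_minus[of "_ * _"] power_minus[of x] algebra_simps)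
    then show ?thesis
      unfolding omega_power_sum six by auto
  qed
  then have "bernoulli_poly n x + bernoulli_poly n (x * omega) + bernoulli_poly n (x * omega\<^sup>2)
    - bernoulli_poly n (- x) - bernoulli_poly n (- (x * omega))
    - bernoulli_poly n (- (x * omega\<^sup>2)) =
    (\<Sum>k\<le>n. if (6::int) dvd int k - 3 then 6 * (c k * x ^ k) else 0)"
    unfolding P sum.distrib[symmetric] sum_subtractf[symmetric] by simp
  also have "\<dots> = (\<Sum>k | k \<le> n \<and> (6::int) dvd int k - 3. 6 * (c k * x ^ k))"
    by (intro sum.mono_neutral_cong_right) auto
  finally show ?thesis
    unfolding sum_distrib_left[symmetric] by (simp add: c_def mult_ac)
qed

text \<open>Induction in steps of two peels off both ends of the range and applies the hypothesis to
  the shifted function, hence the arbitrary \<open>f\<close>.\<close>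

lemma sum_pair_ends:
  fixes f :: "nat \<Rightarrow> 'a::comm_monoid_add"
  assumes "m \<ge> 1"
  shows "(\<Sum>r\<le>m. f r) =
    (\<Sum>r\<le>(m - 1) div 2. f r + f (m - r)) + (if even m then f (m div 2) else 0)"
  using assms
proof (induction m arbitrary: f rule: induct_nat_012)
  case (ge2 m)
  show ?case
  \<comment> \<open>The formula fails at 0, where truncation makes the right side count
    \<open>f 0\<close> three times, so length 2 is checked directly.\<close>
  proof (cases "m = 0")
    case True
    then show ?thesis by (simp add: numeral_2_eq_2 add_ac)
  next
    case False
    then have h: "(Suc (Suc m) - 1) div 2 = Suc ((m - 1) div 2)" by auto
    have "(\<Sum>r\<le>Suc (Suc m). f r) = f 0 + f (Suc (Suc m)) + (\<Sum>r\<le>m. f (Suc r))"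
      unfolding sum.atMost_Suc[of f "Suc m"] sum.atMost_Suc_shift[of f m] by (simp add: add_ac)
    also have "(\<Sum>r\<le>m. f (Suc r)) =
      (\<Sum>r\<le>(m - 1) div 2. f (Suc r) + f (Suc (m - r))) +
      (if even m then f (Suc (m div 2)) else 0)"
      using ge2.IH(1)[of "\<lambda>r. f (Suc r)"] False by simp
    also have "(\<Sum>r\<le>(m - 1) div 2. f (Suc r) + f (Suc (m - r))) =
      (\<Sum>r\<le>(m - 1) div 2. f (Suc r) + f (Suc (Suc m) - Suc r))"
      using False by (intro sum.cong) (auto simp: Suc_diff_le)
    finally show ?thesis
      unfolding h sum.atMost_Suc_shift by (simp add: add_ac)
  qed
qed auto

theorem theorem2p2:
  fixes m n :: nat
  assumes "m \<ge> 1" and "odd n" and "n \<ge> 3"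
  shows "complex_of_real
           (\<Sum>k | k \<le> n \<and> (6::int) dvd int k - 3.
              real (n choose k) * real m ^ k * bernoulli (n - k)) =
         of_nat n / 3 *
           ((\<Sum>r = 1..m - 1. of_nat r ^ (n - 1))
            - (\<Sum>r = 1..(m - 1) div 2.
                 (of_nat r + of_nat m * omega) ^ (n - 1)
                 + (of_nat r + of_nat m * omega\<^sup>2) ^ (n - 1))
            + complex_of_real (delta m n))"
proof -
  let ?P = "bernoulli_poly n" and ?x = "of_nat m :: complex"
  define S1 :: complex where "S1 = (\<Sum>r = 1..m - 1. of_nat r ^ (n - 1))"
  define S2 where "S2 = (\<Sum>r = 1..(m - 1) div 2.
    (of_nat r + ?x * omega) ^ (n - 1) + (of_nat r + ?x * omega\<^sup>2) ^ (n - 1))"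
  \<comment> \<open>The unpaired middle term of the power sum for even m, from m/2 + m
    \<open>omega\<close> = (m/2) sqrt(-3).\<close>
  define M where "M = (if even m then (- 3) ^ ((n - 1) div 2) * (?x / 2) ^ (n - 1) else 0)"
  define f where "f r = (of_nat r + ?x * omega) ^ (n - 1)" for r
  define T where "T = omega ^ (n - 1) + (omega\<^sup>2) ^ (n - 1)"
  have even: "even (n - 1)" using assms(2) by simp
  have refl: "?P (1 - y) = - ?P y" for y
    using assms(2) by (simp add: bernoulli_poly_reflect)
  have neg: "?P (- y) = - ?P y - of_nat n * y ^ (n - 1)" for y
    using refl[of "y + 1"] by (simp add: bernoulli_poly_add_1)

  \<comment> \<open>Reflection gives B_n(1) = -B_n(0), while the difference equation gives B_n(1) =
    B_n(0), as 0^(n-1) = 0.\<close>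
  have "?P 0 = 0"
    using refl[of 0] bernoulli_poly_add_1[of n 0] assms(3) by (simp add: power_0_left)
  then have Pm: "?P ?x = of_nat n * S1"
    using bernoulli_poly_add_of_nat[of n 0 m] assms
    by (simp add: S1_def) (intro disjI2 sum.mono_neutral_right; force simp: power_0_left)

  \<comment> \<open>The two bases differ only in sign, which the even exponent absorbs.\<close>
  have fold: "f (m - r) = (of_nat r + ?x * omega\<^sup>2) ^ (n - 1)" if "r \<le> m" for r
  proof -
    have "of_nat (m - r) + ?x * omega = - (of_nat r + ?x * omega\<^sup>2)"
      using that by (simp add: omega_squared of_nat_diff algebra_simps)
    then show ?thesis unfolding f_def by (simp only: power_minus_even[OF even])
  qed
  have mid: "f (m div 2) = M" if "even m"
  proof -
    from that obtain j where j: "m = 2 * j" by (elim evenE)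
    have "f (m div 2) = (?x / 2 * csqrt (- 3)) ^ (n - 1)"
      unfolding f_def omega_def j by (simp add: field_simps)
    also have "\<dots> = (?x / 2) ^ (n - 1) * csqrt (- 3) ^ (n - 1)"
      by (rule power_mult_distrib)
    also have "csqrt (- 3) ^ (n - 1) = (- 3) ^ ((n - 1) div 2)"
      using even by (metis dvd_mult_div_cancel power2_csqrt power_mult)
    finally show ?thesis
      using that by (simp add: M_def)
  qed
  have "(\<Sum>r\<le>m. f r) = (\<Sum>r\<le>(m - 1) div 2. f r + f (m - r)) + M"
    using sum_pair_ends[OF assms(1), of f] mid by (auto simp: M_def)
  also have "(\<Sum>r\<le>(m - 1) div 2. f r + f (m - r)) =
    (f 0 + f (m - 0)) + (\<Sum>r = 1..(m - 1) div 2. f r + f (m - r))"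
    by (simp add: sum.head[of 0] flip: atLeast0AtMost atLeastSucAtMost_greaterThanAtMost)
  also have "(\<Sum>r = 1..(m - 1) div 2. f r + f (m - r)) = S2"
    unfolding S2_def
    by (intro sum.cong refl arg_cong2[where f = "(+)"] fold) (auto simp: f_def)
  also have "f 0 + f (m - 0) = ?x ^ (n - 1) * T"
    by (simp only: fold[OF le0]) (simp add: f_def T_def power_mult_distrib algebra_simps)
  finally have sum_f: "(\<Sum>r\<le>m. f r) = ?x ^ (n - 1) * T + S2 + M" .

  have "?x * omega\<^sup>2 = 1 - (?x * omega + of_nat (Suc m))"
    by (simp add: omega_squared algebra_simps)
  then have "?P (?x * omega\<^sup>2) = - ?P (?x * omega) - of_nat n * (\<Sum>r\<le>m. f r)"
    using bernoulli_poly_add_of_nat[of n "?x * omega" "Suc m"]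
    by (simp only: refl lessThan_Suc_atMost f_def minus_add_distrib) simp
  then have Pomega: "?P (?x * omega) + ?P (?x * omega\<^sup>2) =
      - of_nat n * (?x ^ (n - 1) * T + S2 + M)"
    unfolding sum_f by simp

  have T: "T = (if 3 dvd n - 1 then 2 else - 1)"
    using omega_power_sum[of "n - 1"] unfolding T_def
    by (auto simp: eq_neg_iff_add_eq_0 add_ac)
  \<comment> \<open>Here (1 + T)/2 collects the corrections from \<open>neg\<close> at the three
    filter points, and -T the end terms r = 0 and r = m of the power sum. The difference is -1/2 or
    1 according to whether 3 divides n - 1.\<close>
  have delta: "complex_of_real (delta m n) = ?x ^ (n - 1) * ((1 + T) / 2 - T) - M"
    by (simp add: delta_def T M_def)

  have "complex_of_real
      (\<Sum>k | k \<le> n \<and> (6::int) dvd int k - 3.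
         real (n choose k) * real m ^ k * bernoulli (n - k)) =
    (\<Sum>k | k \<le> n \<and> (6::int) dvd int k - 3.
      of_nat (n choose k) * ?x ^ k * complex_of_real (bernoulli (n - k)))"
    by simp
  also have "\<dots> = (2 * (?P ?x + (?P (?x * omega) + ?P (?x * omega\<^sup>2)))
      + of_nat n * ?x ^ (n - 1) * (1 + T)) / 6"
    unfolding bernoulli_poly_filter neg T_def
    by (simp add: power_mult_distrib algebra_simps)
  also have "\<dots> = of_nat n / 3 * (S1 - S2 + complex_of_real (delta m n))"
    unfolding Pm Pomega delta by (simp add: field_simps)
  finally show ?thesis unfolding S1_def S2_def .
qed

end
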